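(* Let $(\Phi,\Psi)$ be a pair of complementary Young functions satisfying the GCH-inequality with respect to $E$, let the WCT operator $T=M_wEM_u$ be bounded on $L^\Phi(\Sigma)$, let $\mu(B)=0$, and suppose that for some $m\in\mathbb{N}$ the set $$H_m=\{n\in\mathbb{N}: (E(wu))^m(A_n)\, w(A_n)\,\Psi^{-1}(E(\Psi(u)))(A_n)\ne0\}$$ is finite. Then $\mathcal{R}(M_{E(wu)^j}T)+\mathcal{N}(M_{E(wu)^k}T)$ is closed for all positive integers $j,k$ with $j+k\ge2$. Moreover, $L^\Phi(\Sigma)=\mathcal{R}(M_{E(wu)}T)+\mathcal{N}(M_{E(wu)}T)$.
   Context: $(X,\Sigma,\mu)$ is a complete $\sigma$-finite measure space; functions are complex-valued, identified when equal $\mu$-a.e. An atom is a set $A\in\Sigma$ with $\mu(A)>0$ such that every $F\in\Sigma$ with $F\subset A$ has $\mu(F)=0$ or $\mu(F)=\mu(A)$. $\{A_n\}_{n\in\mathbb{N}}$ is a countable family of pairwise disjoint atoms (indexed by $\mathbb{N}$ or a subset of it) such that $B:=X\setminus\bigcup_n A_n$ contains no atoms; every measurable $f$ is a.e. constant on each atom $A_n$, with value denoted $f(A_n)$. A Young function is a convex even function $\Phi:\mathbb{R}\to[0,\infty]$ with $\Phi(0)=0$, neither identically $0$ nor identically $\infty$ on $(0,\infty)$, and left-continuous at $b_\Phi=\sup\{x>0:\Phi(x)<\infty\}$. For a measurable function $f$, $\Phi(f)$ means $\Phi(|f|)$. The complementary function is $\Psi(y)=\sup\{x|y|-\Phi(x):x\ge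 0\}$. The generalized inverse is $\Phi^{-1}(y)=\inf\{x\ge0:\Phi(x)>y\}$ (with $\inf\emptyset=+\infty$, so $\Phi^{-1}(+\infty)=+\infty$; also $0\cdot\infty=0$), and similarly for $\Psi^{-1}$. The Orlicz space is $L^\Phi(\mu)=L^\Phi(\Sigma)=\{f \text{ measurable}: \exists k>0,\ \int_X\Phi(kf)\,d\mu<\infty\}$, a Banach space with norm $N_\Phi(f)=\inf\{k>0:\int_X\Phi(f/k)\,d\mu\le1\}$. $\mathcal{A}\subseteq\Sigma$ is a sub-$\sigma$-algebra such that $\mu|_{\mathcal A}$ is $\sigma$-finite, and $E=E^{\mathcal A}$ is the conditional expectation: $E(f)$ is the unique $\mathcal A$-measurable function with $\int_A f\,d\mu=\int_A E(f)\,d\mu$ for $A\in\mathcal A$, defined for $f\ge0$ and extended by linearity to measurable $f$ with $E(|f|)<\infty$ a.e. The GCH-inequality holds if there is $C>0$ such that $E(|fg|)\le C\,\Phi^{-1}(E(\Phi(|f|)))\,\Psi^{-1}(E(\Psi(|g|)))$ for all $f\in L^\Phi(\mu)$, $g\in L^\Psi(\mu)$. For measurable $u,w:X\to\mathbb{C}$, the WCT (weighted conditional type) operator $T=M_wEM_u$ is $T(f)=wE(uf)$, where it is understood that $E(uw)$ and $E(uf)$, $f\in L^\Phi(\mu)$, are defined. $M_v$ denotes multiplication by $v$ and $E(wu)^j=(E(wu))^j$. $\mathcal{N}(S)$ and $\mathcal{R}(S)$ denote the null space and range of $S$. $\mathbb{N}=\{1,2,\dots\}$. *)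

theory Defs
  imports "HOL-Probability.Probability"
begin

section \<open>Young functions\<close>

text \<open>If the supremum \<open>b\<close> is infinite, left-continuity at \<open>b\<close> is
  no condition on a function defined on the reals.\<close>

definition young_function :: "(real \<Rightarrow> ennreal) \<Rightarrow> bool" where
  "young_function \<Phi> \<longleftrightarrow>
     (\<forall>x y t. 0 \<le> t \<and> t \<le> 1 \<longrightarrow>
        \<Phi> (t * x + (1 - t) * y) \<le> ennreal t * \<Phi> x + ennreal (1 - t) * \<Phi> y) \<and>
     (\<forall>x. \<Phi> (- x) = \<Phi> x) \<and>
     \<Phi> 0 = 0 \<and>
     (\<exists>x>0. \<Phi> x \<noteq> 0) \<and>
     (\<exists>x>0. \<Phi> x \<noteq> \<infinity>) \<and>
     (\<forall>b::real. (SUP x\<in>{x. x > 0 \<and> \<Phi> x < \<infinity>}. ereal x) = ereal b \<longrightarrow>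
        (\<Phi> \<longlongrightarrow> \<Phi> b) (at_left b))"

text \<open>The difference below is the truncated one of \<^typ>\<open>ennreal\<close>; this does not change the
  supremum, because \<open>x = 0\<close> already contributes the value \<open>0\<close> when \<open>\<Phi> 0 = 0\<close>.\<close>

definition young_conjugate :: "(real \<Rightarrow> ennreal) \<Rightarrow> real \<Rightarrow> ennreal" where
  "young_conjugate \<Phi> y = (SUP x\<in>{0..}. ennreal (x * \<bar>y\<bar>) - \<Phi> x)"

definition complementary_young_pair :: "(real \<Rightarrow> ennreal) \<Rightarrow> (real \<Rightarrow> ennreal) \<Rightarrow> bool" where
  "complementary_young_pair \<Phi> \<Psi> \<longleftrightarrow>
     young_function \<Phi> \<and> young_function \<Psi> \<and> \<Psi> = young_conjugate \<Phi>"

definition young_inverse :: "(real \<Rightarrow> ennreal) \<Rightarrow> ennreal \<Rightarrow> ennreal" where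
  "young_inverse \<Phi> y = Inf {ennreal x | x. x \<ge> 0 \<and> \<Phi> x > y}"


section \<open>Orlicz spaces\<close>

text \<open>Elements of the Orlicz space are functions rather than classes modulo almost everywhere
  equality. Accordingly \<open>orlicz_norm\<close> is a seminorm, and null spaces and ranges below are
  defined so as to be closed under almost everywhere equality; such sets of functions correspond
  exactly to sets of classes.\<close>

definition orlicz_space :: "'a measure \<Rightarrow> (real \<Rightarrow> ennreal) \<Rightarrow> ('a \<Rightarrow> complex) set" where
  "orlicz_space M \<Phi> =
     {f \<in> borel_measurable M. \<exists>k>0. (\<integral>\<^sup>+x. \<Phi> (k * cmod (f x)) \<partial>M) < \<infinity>}"

definition orlicz_norm :: "'a measure \<Rightarrow> (real \<Rightarrow> ennreal) \<Rightarrow> ('a \<Rightarrow> complex) \<Rightarrow> real" where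
  "orlicz_norm M \<Phi> f = Inf {k. k > 0 \<and> (\<integral>\<^sup>+x. \<Phi> (cmod (f x) / k) \<partial>M) \<le> 1}"

definition orlicz_topology :: "'a measure \<Rightarrow> (real \<Rightarrow> ennreal) \<Rightarrow> ('a \<Rightarrow> complex) topology" where
  "orlicz_topology M \<Phi> = topology (\<lambda>U. U \<subseteq> orlicz_space M \<Phi> \<and>
     (\<forall>f\<in>U. \<exists>e>0. \<forall>g\<in>orlicz_space M \<Phi>. orlicz_norm M \<Phi> (\<lambda>x. g x - f x) < e \<longrightarrow> g \<in> U))"

lemma openin_orlicz_topology:
  "openin (orlicz_topology M \<Phi>) U \<longleftrightarrow> U \<subseteq> orlicz_space M \<Phi> \<and>
     (\<forall>f\<in>U. \<exists>e>0. \<forall>g\<in>orlicz_space M \<Phi>. orlicz_norm M \<Phi> (\<lambda>x. g x - f x) < e \<longrightarrow> g \<in> U)"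
proof -
  define P where "P U \<longleftrightarrow> U \<subseteq> orlicz_space M \<Phi> \<and>
     (\<forall>f\<in>U. \<exists>e>0. \<forall>g\<in>orlicz_space M \<Phi>. orlicz_norm M \<Phi> (\<lambda>x. g x - f x) < e \<longrightarrow> g \<in> U)" for U
  have "P (S \<inter> T)" if S: "P S" and T: "P T" for S T
    unfolding P_def
  proof (intro conjI ballI)
    show "S \<inter> T \<subseteq> orlicz_space M \<Phi>"
      using S by (auto simp: P_def)
    fix f assume f: "f \<in> S \<inter> T"
    obtain d where d: "d > 0"
      "\<forall>g\<in>orlicz_space M \<Phi>. orlicz_norm M \<Phi> (\<lambda>x. g x - f x) < d \<longrightarrow> g \<in> S"
      using S f unfolding P_def by blast
    obtain e where e: "e > 0"
      "\<forall>g\<in>orlicz_space M \<Phi>. orlicz_norm M \<Phi> (\<lambda>x. g x - f x) < e \<longrightarrow> g \<in> T"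
      using T f unfolding P_def by blast
    show "\<exists>e>0. \<forall>g\<in>orlicz_space M \<Phi>. orlicz_norm M \<Phi> (\<lambda>x. g x - f x) < e \<longrightarrow> g \<in> S \<inter> T"
      using d e by (intro exI[of _ "min d e"]) auto
  qed
  moreover have "P (\<Union>\<K>)" if "\<forall>K\<in>\<K>. P K" for \<K>
    using that unfolding P_def by (meson Sup_le_iff Union_iff)
  ultimately have "istopology P"
    unfolding istopology_def by blast
  then have "openin (topology P) U \<longleftrightarrow> P U"
    by (simp add: topology_inverse')
  moreover have "orlicz_topology M \<Phi> = topology P"
    by (simp add: orlicz_topology_def P_def[abs_def])
  ultimately show ?thesis
    by (simp add: P_def)
qed

definition bounded_on_orlicz ::
    "'a measure \<Rightarrow> (real \<Rightarrow> ennreal) \<Rightarrow> (('a \<Rightarrow> complex) \<Rightarrow> 'a \<Rightarrow> complex) \<Rightarrow> bool" where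
  "bounded_on_orlicz M \<Phi> S \<longleftrightarrow>
     (\<forall>f\<in>orlicz_space M \<Phi>. S f \<in> orlicz_space M \<Phi>) \<and>
     (\<exists>K. \<forall>f\<in>orlicz_space M \<Phi>. orlicz_norm M \<Phi> (S f) \<le> K * orlicz_norm M \<Phi> f)"

definition null_space ::
    "'a measure \<Rightarrow> (real \<Rightarrow> ennreal) \<Rightarrow> (('a \<Rightarrow> complex) \<Rightarrow> 'a \<Rightarrow> complex) \<Rightarrow> ('a \<Rightarrow> complex) set" where
  "null_space M \<Phi> S = {f \<in> orlicz_space M \<Phi>. AE x in M. S f x = 0}"

definition range_space ::
    "'a measure \<Rightarrow> (real \<Rightarrow> ennreal) \<Rightarrow> (('a \<Rightarrow> complex) \<Rightarrow> 'a \<Rightarrow> complex) \<Rightarrow> ('a \<Rightarrow> complex) set" where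
  "range_space M \<Phi> S =
     {g \<in> orlicz_space M \<Phi>. \<exists>f\<in>orlicz_space M \<Phi>. AE x in M. g x = S f x}"

definition sum_space :: "('a \<Rightarrow> complex) set \<Rightarrow> ('a \<Rightarrow> complex) set \<Rightarrow> ('a \<Rightarrow> complex) set" where
  "sum_space V W = {\<lambda>x. f x + g x | f g. f \<in> V \<and> g \<in> W}"


section \<open>Atoms\<close>

definition is_atom :: "'a measure \<Rightarrow> 'a set \<Rightarrow> bool" where
  "is_atom M A \<longleftrightarrow> A \<in> sets M \<and> emeasure M A > 0 \<and>
     (\<forall>F\<in>sets M. F \<subseteq> A \<longrightarrow> emeasure M F = 0 \<or> emeasure M F = emeasure M A)"

definition atomic_decomposition ::
    "'a measure \<Rightarrow> nat set \<Rightarrow> (nat \<Rightarrow> 'a set) \<Rightarrow> 'a set \<Rightarrow> bool" where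
  "atomic_decomposition M I A B \<longleftrightarrow>
     (\<forall>n\<in>I. is_atom M (A n)) \<and> disjoint_family_on A I \<and>
     B = space M - (\<Union>n\<in>I. A n) \<and> (\<nexists>C. is_atom M C \<and> C \<subseteq> B)"

definition atom_value :: "'a measure \<Rightarrow> ('a \<Rightarrow> 'b) \<Rightarrow> 'a set \<Rightarrow> 'b" where
  "atom_value M f A = (THE c. AE x in M. x \<in> A \<longrightarrow> f x = c)"


section \<open>Conditional expectation and weighted conditional type operators\<close>

definition cond_exp_defined :: "'a measure \<Rightarrow> 'a measure \<Rightarrow> ('a \<Rightarrow> complex) \<Rightarrow> bool" where
  "cond_exp_defined M F f \<longleftrightarrow>
     f \<in> borel_measurable M \<and> (AE x in M. nn_cond_exp M F (\<lambda>x. ennreal (cmod (f x))) x < \<infinity>)"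

text \<open>Although \<^const>\<open>real_cond_exp\<close> is mostly used for integrable functions, it is defined as
  the difference of the conditional expectations of the positive and negative parts, so it is the
  right notion whenever \<^const>\<open>cond_exp_defined\<close> holds.\<close>

definition complex_cond_exp ::
    "'a measure \<Rightarrow> 'a measure \<Rightarrow> ('a \<Rightarrow> complex) \<Rightarrow> 'a \<Rightarrow> complex" where
  "complex_cond_exp M F f x =
     Complex (real_cond_exp M F (\<lambda>x. Re (f x)) x) (real_cond_exp M F (\<lambda>x. Im (f x)) x)"

definition GCH_inequality ::
    "'a measure \<Rightarrow> 'a measure \<Rightarrow> (real \<Rightarrow> ennreal) \<Rightarrow> (real \<Rightarrow> ennreal) \<Rightarrow> bool" where
  "GCH_inequality M F \<Phi> \<Psi> \<longleftrightarrow>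
     (\<exists>C::real. C > 0 \<and> (\<forall>f\<in>orlicz_space M \<Phi>. \<forall>g\<in>orlicz_space M \<Psi>. AE x in M.
        nn_cond_exp M F (\<lambda>x. ennreal (cmod (f x * g x))) x
          \<le> ennreal C * young_inverse \<Phi> (nn_cond_exp M F (\<lambda>x. \<Phi> (cmod (f x))) x)
                      * young_inverse \<Psi> (nn_cond_exp M F (\<lambda>x. \<Psi> (cmod (g x))) x)))"

definition mult_op :: "('a \<Rightarrow> complex) \<Rightarrow> ('a \<Rightarrow> complex) \<Rightarrow> 'a \<Rightarrow> complex" where
  "mult_op v f = (\<lambda>x. v x * f x)"

definition wct_op ::
    "'a measure \<Rightarrow> 'a measure \<Rightarrow> ('a \<Rightarrow> complex) \<Rightarrow> ('a \<Rightarrow> complex) \<Rightarrow> ('a \<Rightarrow> complex) \<Rightarrow> 'a \<Rightarrow> complex" where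
  "wct_op M F w u = mult_op w \<circ> complex_cond_exp M F \<circ> mult_op u"

definition wct_defined ::
    "'a measure \<Rightarrow> 'a measure \<Rightarrow> (real \<Rightarrow> ennreal) \<Rightarrow> ('a \<Rightarrow> complex) \<Rightarrow> ('a \<Rightarrow> complex) \<Rightarrow> bool" where
  "wct_defined M F \<Phi> w u \<longleftrightarrow> cond_exp_defined M F (mult_op u w) \<and>
     (\<forall>f\<in>orlicz_space M \<Phi>. cond_exp_defined M F (mult_op u f))"

text \<open>The defining product of \<open>H_set\<close> mixes complex factors with a factor in \<open>[0,\<infinity>]\<close>; it is
  formed in \<^typ>\<open>ennreal\<close> after taking moduli, where \<open>0 * \<infinity> = 0\<close>.\<close>

definition H_set ::
    "'a measure \<Rightarrow> 'a measure \<Rightarrow> (real \<Rightarrow> ennreal) \<Rightarrow> nat set \<Rightarrow> (nat \<Rightarrow> 'a set) \<Rightarrow>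
     ('a \<Rightarrow> complex) \<Rightarrow> ('a \<Rightarrow> complex) \<Rightarrow> nat \<Rightarrow> nat set" where
  "H_set M F \<Psi> I A w u m = {n \<in> I.
     ennreal (cmod (atom_value M (\<lambda>x. complex_cond_exp M F (mult_op w u) x ^ m) (A n)
                    * atom_value M w (A n)))
     * atom_value M (\<lambda>x. young_inverse \<Psi> (nn_cond_exp M F (\<lambda>x. \<Psi> (cmod (u x))) x)) (A n) \<noteq> 0}"

end

theory Submission
  imports Defs
begin

text \<open>Write \<open>T f = w E(u f)\<close> and \<open>e = E(w u)\<close>. The theorem holds because the sum of range and null
  space is the whole Orlicz space for every \<open>j\<close> and every \<open>k \<ge> 1\<close>; the closedness statement is then
  trivial, and the second claim is the case \<open>j = k = 1\<close>.

  The splitting of a given \<open>f\<close> is explicit. Functions measurable for the subalgebra can be pulled out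
  of \<open>E\<close>, so \<open>T (\<phi> w) = \<phi> e w\<close> for such \<open>\<phi>\<close>. Put \<open>h\<^sub>i = w E(u f) / e^(i+1)\<close>, read as \<open>0\<close> where
  \<open>e = 0\<close>. Then \<open>e^j T h\<^sub>j\<^sub>+\<^sub>1 = h\<^sub>0\<close>, so \<open>h\<^sub>0\<close> lies in the range, and \<open>T h\<^sub>0 = T f\<close> where \<open>e \<noteq> 0\<close>, so
  \<open>e^k T (f - h\<^sub>0) = 0\<close>.

  What has to be shown is that the functions \<open>h\<^sub>i\<close> belong to the Orlicz space, and this is where the
  finiteness of \<open>H\<^sub>m\<close> enters. On an atom, \<open>\<Psi>\<^sup>-\<^sup>1(E(\<Psi>(u))) = 0\<close> forces \<open>u\<close>, and hence \<open>e\<close>, to vanish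
  (\<open>cond_exp_vanishes_where_factor_vanishes\<close>), so \<open>H\<^sub>m\<close> is just the set of atoms on which \<open>e w \<noteq> 0\<close>.
  As \<open>B\<close> is null, \<open>h\<^sub>i\<close> lives on the finitely many atoms of \<open>H\<^sub>m\<close>, each of which has
  finite measure and, up to a null set, carries only one value of \<open>h\<^sub>i\<close>. Such a function is in every Orlicz space
  (\<open>bounded_finite_support_in_orlicz_space\<close>).

  The pull-out property is needed for functions that are not integrable and only satisfy
  \<open>E(|f|) < \<infinity>\<close> almost everywhere; it is derived here from the conditional expectation of
  nonnegative functions.\<close>

section \<open>Young functions and Orlicz spaces\<close>

text \<open>Superlevel sets of a monotone function are upward closed, hence rays.\<close>

lemma mono_imp_borel_measurable:
  fixes f :: "'a::{complete_linorder, linorder_topology, second_countable_topology} \<Rightarrow>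
              'b::{linorder_topology, second_countable_topology}"
  assumes "mono f"
  shows "f \<in> borel_measurable borel"
proof (rule borel_measurableI_greater)
  fix y
  define U where "U = {x. y < f x}"
  have up: "x' \<in> U" if "x \<in> U" "x \<le> x'" for x x'
    using that monoD[OF assms, of x x'] by (auto simp: U_def)
  have "U = {Inf U..} \<or> U = {Inf U<..}"
  proof (cases "Inf U \<in> U")
    case True
    then have "U = {Inf U..}"
      using up by (auto intro: Inf_lower)
    then show ?thesis ..
  next
    case False
    have "U = {Inf U<..}"
    proof safe
      fix x assume "x \<in> U"
      then show "Inf U < x"
        using False by (metis Inf_lower order_le_imp_less_or_eq)
    next
      fix x assume "Inf U < x"
      then show "x \<in> U"
        using up by (auto simp: Inf_less_iff intro: less_imp_le)
    qed
    then show ?thesis ..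
  qed
  then have "U \<in> sets borel"
    by (metis atLeast_borel greaterThan_borel)
  then show "{x \<in> space borel. y < f x} \<in> sets borel"
    by (simp add: U_def)
qed

lemma young_mono:
  assumes "young_function \<Phi>" "0 \<le> x" "x \<le> y"
  shows "\<Phi> x \<le> \<Phi> y"
proof (cases "y = 0")
  case True
  then show ?thesis using assms by simp
next
  case False
  with assms have y: "y > 0" by simp
  have "\<Phi> ((x / y) * y + (1 - x / y) * 0) \<le> ennreal (x / y) * \<Phi> y + ennreal (1 - x / y) * \<Phi> 0"
    using assms y unfolding young_function_def by (metis divide_le_eq_1_pos divide_nonneg_pos)
  also have "\<dots> \<le> 1 * \<Phi> y"
  proof -
    have "ennreal (x / y) \<le> 1"
      using assms y by simp
    then have "ennreal (x / y) * \<Phi> y \<le> 1 * \<Phi> y"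
      by (rule mult_right_mono) simp
    then show ?thesis
      using assms(1) by (simp add: young_function_def)
  qed
  finally show ?thesis
    using y by simp
qed

lemma young_finite_point:
  assumes "young_function \<Phi>"
  obtains a where "a > 0" "\<Phi> a < \<infinity>"
  using assms unfolding young_function_def by (auto simp: less_top)

text \<open>A Young function is monotone only on the nonnegative half-line, so it is first transported to a
  monotone function on \<^typ>\<open>ennreal\<close>.\<close>

lemma young_measurable [measurable (raw)]:
  assumes Y: "young_function \<Phi>" and [measurable]: "f \<in> borel_measurable M"
    and nonneg: "\<And>x. 0 \<le> f x"
  shows "(\<lambda>x. \<Phi> (f x)) \<in> borel_measurable M"
proof -
  define \<Phi>' :: "ennreal \<Rightarrow> ennreal" where "\<Phi>' y = (if y = \<infinity> then \<infinity> else \<Phi> (enn2real y))" for y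
  have "mono \<Phi>'"
    by (auto simp: mono_def \<Phi>'_def less_top top_unique intro!: young_mono[OF Y] enn2real_mono)
  then have [measurable]: "\<Phi>' \<in> borel_measurable borel"
    by (rule mono_imp_borel_measurable)
  have "(\<lambda>x. \<Phi> (f x)) = (\<lambda>x. \<Phi>' (ennreal (f x)))"
    by (auto simp: \<Phi>'_def nonneg)
  then show ?thesis by simp
qed

lemma young_inverse_mono: "mono (young_inverse \<Phi>)"
  unfolding mono_def young_inverse_def by (auto intro!: Inf_superset_mono intro: le_less_trans)

text \<open>The generalized inverse is bounded below by every \<open>x\<close> with \<open>\<Psi> x \<le> y\<close>. If it vanishes, no
  positive \<open>x\<close> satisfies this inequality. But \<open>\<Psi>\<close> is finite somewhere and convex with \<open>\<Psi> 0 = 0\<close>,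
  so it takes arbitrarily small values at positive points, which leaves only \<open>y = 0\<close>.\<close>

lemma young_inverse_eq_0:
  assumes Y: "young_function \<Psi>" and z: "young_inverse \<Psi> y = 0"
  shows "y = 0" and "\<And>x. x > 0 \<Longrightarrow> \<Psi> x > 0"
proof -
  have above: "\<not> \<Psi> x \<le> y" if "x > 0" for x
  proof
    assume le: "\<Psi> x \<le> y"
    have "ennreal x \<le> young_inverse \<Psi> y"
      unfolding young_inverse_def
    proof (rule Inf_greatest, clarify)
      fix x' assume "0 \<le> x'" "y < \<Psi> x'"
      then have "\<not> x' \<le> x"
        using young_mono[OF Y, of x' x] le by (metis leD order_trans)
      then show "ennreal x \<le> ennreal x'"
        by (simp add: ennreal_leI)
    qed
    then show False
      using z that by simp
  qed
  show "\<Psi> x > 0" if "x > 0" for x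
    using above[OF that] by (auto simp: not_le intro: le_less_trans[OF zero_le])
  show "y = 0"
  proof (rule ccontr)
    assume "y \<noteq> 0"
    obtain a where a: "a > 0" "\<Psi> a < \<infinity>"
      using young_finite_point[OF Y] .
    obtain b where b: "b \<ge> 0" "\<Psi> a = ennreal b"
      using a by (cases "\<Psi> a") auto
    obtain e where e: "e > 0" "ennreal e \<le> y"
    proof (cases y)
      case (real r)
      then show ?thesis
        using \<open>y \<noteq> 0\<close> by (intro that[of r]) auto
    next
      case top
      then show ?thesis by (intro that[of 1]) auto
    qed
    \<comment> \<open>Convexity gives \<open>\<Psi> (t * a) \<le> t * \<Psi> a = t * b\<close>; the \<open>+ 1\<close> guards against \<open>b = 0\<close>.\<close>
    define t where "t = min 1 (e / (b + 1))"
    have t: "0 < t" "t \<le> 1" "t * b \<le> e"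
    proof -
      show "0 < t" "t \<le> 1" using e b by (auto simp: t_def)
      have "t * b \<le> t * (b + 1)" using \<open>0 < t\<close> by simp
      also have "\<dots> \<le> e / (b + 1) * (b + 1)"
        using b by (intro mult_right_mono) (auto simp: t_def)
      also have "\<dots> = e" using b by simp
      finally show "t * b \<le> e" .
    qed
    have "\<Psi> (t * a + (1 - t) * 0) \<le> ennreal t * \<Psi> a + ennreal (1 - t) * \<Psi> 0"
      using Y t unfolding young_function_def by (meson less_imp_le)
    also have "\<dots> = ennreal (t * b)"
      using Y t b by (simp add: young_function_def ennreal_mult)
    also have "\<dots> \<le> y"
      using t e by (meson ennreal_leI order_trans)
    finally show False
      using above[of "t * a"] t a by simp
  qed
qed

lemma orlicz_space_diff:
  assumes Y: "young_function \<Phi>" and f: "f \<in> orlicz_space M \<Phi>" and g: "g \<in> orlicz_space M \<Phi>"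
  shows "(\<lambda>x. f x - g x) \<in> orlicz_space M \<Phi>"
proof -
  have [measurable]: "f \<in> borel_measurable M" "g \<in> borel_measurable M"
    using f g by (auto simp: orlicz_space_def)
  obtain k where k: "k > 0" "(\<integral>\<^sup>+x. \<Phi> (k * cmod (f x)) \<partial>M) < \<infinity>"
    using f by (auto simp: orlicz_space_def)
  obtain l where l: "l > 0" "(\<integral>\<^sup>+x. \<Phi> (l * cmod (g x)) \<partial>M) < \<infinity>"
    using g by (auto simp: orlicz_space_def)
  \<comment> \<open>Halving makes \<open>c * \<bar>f - g\<bar>\<close> at most the larger of \<open>k * \<bar>f\<bar>\<close> and \<open>l * \<bar>g\<bar>\<close>, so monotonicity
    suffices.\<close>
  define c where "c = min k l / 2"
  have c: "c > 0" "2 * c \<le> k" "2 * c \<le> l"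
    using k l by (auto simp: c_def)
  have bound: "\<Phi> (c * cmod (f x - g x)) \<le> \<Phi> (k * cmod (f x)) + \<Phi> (l * cmod (g x))" for x
  proof -
    define s where "s = max (k * cmod (f x)) (l * cmod (g x))"
    have "c * cmod (f x - g x) \<le> c * cmod (f x) + c * cmod (g x)"
      using c norm_triangle_ineq4[of "f x" "g x"] by (simp flip: distrib_left)
    moreover have "2 * c * cmod (f x) \<le> k * cmod (f x)" "2 * c * cmod (g x) \<le> l * cmod (g x)"
      using c by (auto intro!: mult_right_mono)
    ultimately have "c * cmod (f x - g x) \<le> s"
      by (simp add: s_def)
    then have "\<Phi> (c * cmod (f x - g x)) \<le> \<Phi> s"
      using c by (intro young_mono[OF Y]) auto
    also have "\<dots> \<le> \<Phi> (k * cmod (f x)) + \<Phi> (l * cmod (g x))"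
      by (auto simp: s_def max_def)
    finally show ?thesis .
  qed
  have "(\<integral>\<^sup>+x. \<Phi> (c * cmod (f x - g x)) \<partial>M)
      \<le> (\<integral>\<^sup>+x. \<Phi> (k * cmod (f x)) + \<Phi> (l * cmod (g x)) \<partial>M)"
    by (intro nn_integral_mono bound)
  also have "\<dots> = (\<integral>\<^sup>+x. \<Phi> (k * cmod (f x)) \<partial>M) + (\<integral>\<^sup>+x. \<Phi> (l * cmod (g x)) \<partial>M)"
    using k l by (intro nn_integral_add young_measurable[OF Y]) auto
  also have "\<dots> < \<infinity>"
    using k l by auto
  finally show ?thesis
    using c by (auto simp: orlicz_space_def)
qed

lemma orlicz_space_uminus:
  assumes "f \<in> orlicz_space M \<Phi>"
  shows "(\<lambda>x. - f x) \<in> orlicz_space M \<Phi>"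
  using assms by (auto simp: orlicz_space_def)

lemma orlicz_space_add:
  assumes "young_function \<Phi>" "f \<in> orlicz_space M \<Phi>" "g \<in> orlicz_space M \<Phi>"
  shows "(\<lambda>x. f x + g x) \<in> orlicz_space M \<Phi>"
  using orlicz_space_diff[OF assms(1,2) orlicz_space_uminus[OF assms(3)]] by simp

text \<open>After scaling, the function takes values below a point where \<open>\<Phi>\<close> is finite.\<close>

lemma bounded_finite_support_in_orlicz_space:
  assumes Y: "young_function \<Phi>" and [measurable]: "h \<in> borel_measurable M" "S \<in> sets M"
    and fin: "emeasure M S < \<infinity>"
    and bd: "AE x in M. cmod (h x) \<le> C * indicator S x"
  shows "h \<in> orlicz_space M \<Phi>"
proof -
  obtain a where a: "a > 0" "\<Phi> a < \<infinity>"
    using young_finite_point[OF Y] .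
  define k where "k = a / (\<bar>C\<bar> + 1)"
  have k: "k > 0" "k * \<bar>C\<bar> \<le> a"
    using a by (auto simp: k_def field_simps)
  have "(\<integral>\<^sup>+x. \<Phi> (k * cmod (h x)) \<partial>M) \<le> (\<integral>\<^sup>+x. \<Phi> a * indicator S x \<partial>M)"
  proof (rule nn_integral_mono_AE, use bd in eventually_elim)
    fix x assume le: "cmod (h x) \<le> C * indicator S x"
    show "\<Phi> (k * cmod (h x)) \<le> \<Phi> a * indicator S x"
    proof (cases "x \<in> S")
      case True
      then have "k * cmod (h x) \<le> k * \<bar>C\<bar>"
        using le k by (intro mult_left_mono) auto
      also have "\<dots> \<le> a" by (rule k)
      finally have "k * cmod (h x) \<le> a" .
      then show ?thesis
        using True k by (auto intro!: young_mono[OF Y])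
    next
      case False
      then show ?thesis
        using le Y by (simp add: young_function_def)
    qed
  qed
  also have "\<dots> = \<Phi> a * emeasure M S"
    by (simp add: nn_integral_cmult_indicator)
  also have "\<dots> < \<infinity>"
    using a fin by (simp add: ennreal_mult_less_top)
  finally show ?thesis
    using k by (auto simp: orlicz_space_def)
qed

lemma topspace_orlicz_topology: "topspace (orlicz_topology M \<Phi>) = orlicz_space M \<Phi>"
proof -
  have "openin (orlicz_topology M \<Phi>) (orlicz_space M \<Phi>)"
    by (auto simp: openin_orlicz_topology intro: exI[of _ 1])
  then show ?thesis
    by (metis openin_orlicz_topology openin_subset openin_topspace subset_antisym)
qed

section \<open>Atoms\<close>

text \<open>Some set of finite measure meets the atom in a set of positive measure, which then has the full
  measure of the atom.\<close>

lemma atom_finite_measure: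
  assumes "sigma_finite_measure M" "is_atom M A"
  shows "emeasure M A < \<infinity>"
proof -
  interpret sigma_finite_measure M by fact
  obtain S :: "nat \<Rightarrow> 'a set" where S: "range S \<subseteq> sets M" "(\<Union>i. S i) = space M"
      "\<And>i. emeasure M (S i) \<noteq> \<infinity>"
    using sigma_finite by blast
  have A: "A \<in> sets M" "emeasure M A > 0"
    "\<And>F. F \<in> sets M \<Longrightarrow> F \<subseteq> A \<Longrightarrow> emeasure M F = 0 \<or> emeasure M F = emeasure M A"
    using assms(2) by (auto simp: is_atom_def)
  have "\<exists>i. emeasure M (A \<inter> S i) \<noteq> 0"
  proof (rule ccontr)
    assume "\<not> ?thesis"
    then have "emeasure M (\<Union>i. A \<inter> S i) = 0"
      using A S by (intro emeasure_UN_eq_0) auto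
    moreover have "(\<Union>i. A \<inter> S i) = A"
      using S(2) sets.sets_into_space[OF A(1)] by auto
    ultimately show False using A by simp
  qed
  then obtain i where "emeasure M (A \<inter> S i) \<noteq> 0" ..
  then have "emeasure M A = emeasure M (A \<inter> S i)"
    using A(3)[of "A \<inter> S i"] A(1) S(1) by auto
  also have "\<dots> \<le> emeasure M (S i)"
    using S A by (intro emeasure_mono) auto
  finally show ?thesis
    using S(3)[of i] by (simp add: less_top[symmetric] top_unique) (metis top_unique)
qed

lemma not_AE_outside_atom:
  assumes "is_atom M A"
  shows "\<not> (AE x in M. x \<notin> A)"
proof
  assume ae: "AE x in M. x \<notin> A"
  have A: "A \<in> sets M" "emeasure M A > 0"
    using assms by (auto simp: is_atom_def)
  have "{x \<in> space M. \<not> x \<notin> A} = A"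
    using sets.sets_into_space[OF A(1)] by auto
  then have "emeasure M A = 0"
    using ae A by (simp add: AE_iff_measurable[OF A(1)])
  then show False using A by simp
qed

text \<open>The preimage of each set of a countable basis is null or conull in the atom. Some point \<open>a\<close> of
  the atom avoids all the null preimages, and then the preimages of all basic neighbourhoods of
  \<open>f a\<close> are conull; these neighbourhoods intersect in \<open>{f a}\<close>.\<close>

lemma ae_constant_on_atom:
  fixes f :: "'a \<Rightarrow> 'b::{second_countable_topology, t1_space}"
  assumes sf: "sigma_finite_measure M" and at: "is_atom M A"
    and [measurable]: "f \<in> borel_measurable M"
  obtains c where "AE x in M. x \<in> A \<longrightarrow> f x = c"
proof -
  have A[measurable]: "A \<in> sets M"
    and dich: "\<And>F. F \<in> sets M \<Longrightarrow> F \<subseteq> A \<Longrightarrow> emeasure M F = 0 \<or> emeasure M F = emeasure M A"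
    using at by (auto simp: is_atom_def)
  have Asp: "A \<subseteq> space M" using A by (rule sets.sets_into_space)
  obtain \<B> :: "'b set set" where cB: "countable \<B>" and bB: "topological_basis \<B>"
    using ex_countable_basis by blast
  have op: "open U" if "U \<in> \<B>" for U
    using bB that by (rule topological_basis_open)
  define \<N> where "\<N> = {U\<in>\<B>. AE x in M. x \<in> A \<longrightarrow> f x \<notin> U}"
  have cN: "countable \<N>"
    using cB by (auto simp: \<N>_def)
  have "AE x in M. \<forall>U\<in>\<N>. x \<in> A \<longrightarrow> f x \<notin> U"
    using cN by (subst AE_ball_countable) (auto simp: \<N>_def)
  have "\<exists>x\<in>A. \<forall>U\<in>\<N>. f x \<notin> U"
  proof (rule ccontr)
    assume none: "\<not> ?thesis"
    have "AE x in M. x \<notin> A"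
      using \<open>AE x in M. \<forall>U\<in>\<N>. x \<in> A \<longrightarrow> f x \<notin> U\<close> by eventually_elim (use none in blast)
    then show False using not_AE_outside_atom[OF at] by simp
  qed
  then obtain a where a: "a \<in> A" "\<forall>U\<in>\<N>. f a \<notin> U" by blast
  have full: "AE x in M. x \<in> A \<longrightarrow> f x \<in> U" if U: "U \<in> \<B>" "f a \<in> U" for U
  proof -
    have [measurable]: "U \<in> sets borel" using op[OF U(1)] by simp
    define D where "D = {x\<in>A. f x \<in> U}"
    have D: "D = A \<inter> (f -` U \<inter> space M)" using Asp by (auto simp: D_def)
    have Dm[measurable]: "D \<in> sets M" unfolding D by measurable
    have "emeasure M D \<noteq> 0"
    proof
      assume "emeasure M D = 0"
      then have "AE x in M. x \<notin> D"
        by (intro AE_not_in) (auto simp: null_sets_def)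
      then have "AE x in M. x \<in> A \<longrightarrow> f x \<notin> U"
        by eventually_elim (auto simp: D_def)
      then have "U \<in> \<N>" using U by (simp add: \<N>_def)
      then show False using a U by blast
    qed
    then have eq: "emeasure M D = emeasure M A"
      using dich[of D] by (auto simp: D_def)
    have "emeasure M (A - D) = emeasure M A - emeasure M D"
      using atom_finite_measure[OF sf at] eq by (intro emeasure_Diff) (auto simp: D_def)
    then have "emeasure M (A - D) = 0"
      using eq atom_finite_measure[OF sf at] by simp
    then have "AE x in M. x \<notin> A - D"
      by (intro AE_not_in) (auto simp: null_sets_def)
    then show ?thesis
      by eventually_elim (auto simp: D_def)
  qed
  have "AE x in M. \<forall>U\<in>{U\<in>\<B>. f a \<in> U}. x \<in> A \<longrightarrow> f x \<in> U"
    using cB full by (subst AE_ball_countable) auto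
  then have "AE x in M. x \<in> A \<longrightarrow> f x = f a"
  proof eventually_elim
    fix x assume all: "\<forall>U\<in>{U\<in>\<B>. f a \<in> U}. x \<in> A \<longrightarrow> f x \<in> U"
    show "x \<in> A \<longrightarrow> f x = f a"
    proof (intro impI, rule ccontr)
      assume x: "x \<in> A" "f x \<noteq> f a"
      then obtain V where V: "open V" "f a \<in> V" "f x \<notin> V"
        using t1_space by metis
      then obtain U where "U \<in> \<B>" "f a \<in> U" "U \<subseteq> V"
        using topological_basisE[OF bB] by metis
      then show False using all x V by blast
    qed
  qed
  then show ?thesis by (rule that)
qed

lemma atom_value_ae:
  fixes f :: "'a \<Rightarrow> 'b::{second_countable_topology, t1_space}"
  assumes sf: "sigma_finite_measure M" and at: "is_atom M A"
    and f: "f \<in> borel_measurable M"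
  shows "AE x in M. x \<in> A \<longrightarrow> f x = atom_value M f A"
proof -
  obtain c where c: "AE x in M. x \<in> A \<longrightarrow> f x = c"
    using ae_constant_on_atom[OF sf at f] .
  have "d = c" if d: "AE x in M. x \<in> A \<longrightarrow> f x = d" for d
  proof (rule ccontr)
    assume "d \<noteq> c"
    have "AE x in M. x \<notin> A"
      using c d by eventually_elim (use \<open>d \<noteq> c\<close> in auto)
    then show False using not_AE_outside_atom[OF at] by simp
  qed
  then have "atom_value M f A = c"
    unfolding atom_value_def using c by blast
  then show ?thesis using c by simp
qed

section \<open>Conditional expectation beyond integrable functions\<close>

context sigma_finite_subalgebra
begin

text \<open>The real analogue of \<^const>\<open>cond_exp_defined\<close>, inherited by real and imaginary parts.\<close>

definition real_cond_exp_defined :: "('a \<Rightarrow> real) \<Rightarrow> bool" where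
  "real_cond_exp_defined f \<longleftrightarrow>
     f \<in> borel_measurable M \<and> (AE x in M. nn_cond_exp M F (\<lambda>x. ennreal \<bar>f x\<bar>) x < \<infinity>)"

lemma nn_cond_exp_finite_mono:
  assumes "AE x in M. nn_cond_exp M F g x < \<infinity>" "\<And>x. f x \<le> g x"
    "f \<in> borel_measurable M" "g \<in> borel_measurable M"
  shows "AE x in M. nn_cond_exp M F f x < \<infinity>"
proof -
  have "AE x in M. nn_cond_exp M F f x \<le> nn_cond_exp M F g x"
    using assms by (intro nn_cond_exp_mono) auto
  with assms(1) show ?thesis
    by eventually_elim (rule le_less_trans)
qed

lemma nn_cond_exp_finite_sum:
  assumes "AE x in M. nn_cond_exp M F f x < \<infinity>" "AE x in M. nn_cond_exp M F g x < \<infinity>"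
    and [measurable]: "f \<in> borel_measurable M" "g \<in> borel_measurable M"
  shows "AE x in M. nn_cond_exp M F (\<lambda>x. f x + g x) x < \<infinity>"
  using nn_cond_exp_sum[OF assms(3,4)] assms(1,2)
  by eventually_elim (metis ennreal_add_less_top infinity_ennreal_def)

lemma nn_cond_exp_finite_prod:
  assumes "AE x in M. nn_cond_exp M F g x < \<infinity>" "\<And>x. f x < \<infinity>"
    and [measurable]: "f \<in> borel_measurable F" "g \<in> borel_measurable M"
  shows "AE x in M. nn_cond_exp M F (\<lambda>x. f x * g x) x < \<infinity>"
  using nn_cond_exp_prod[OF assms(3,4)] assms(1)
  by eventually_elim (metis assms(2) ennreal_mult_less_top infinity_ennreal_def)

text \<open>The conditional expectation may be computed from any splitting into a difference of nonnegative
  functions, not only from positive and negative parts \<open>p\<close> and \<open>q\<close>: since \<open>p + b = q + a\<close>, additivity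
  on nonnegative functions gives the claim once all terms are finite. Additivity and the pull-out
  property for signed functions follow from suitable splittings.\<close>

lemma real_cond_exp_difference:
  assumes [measurable]: "a \<in> borel_measurable M" "b \<in> borel_measurable M"
    and nonneg: "\<And>x. 0 \<le> a x" "\<And>x. 0 \<le> b x"
    and fin: "AE x in M. nn_cond_exp M F (\<lambda>x. ennreal (a x)) x < \<infinity>"
      "AE x in M. nn_cond_exp M F (\<lambda>x. ennreal (b x)) x < \<infinity>"
  shows "AE x in M. real_cond_exp M F (\<lambda>x. a x - b x) x =
    enn2real (nn_cond_exp M F (\<lambda>x. ennreal (a x)) x) -
    enn2real (nn_cond_exp M F (\<lambda>x. ennreal (b x)) x)"
proof -
  define p q where "p = (\<lambda>x. ennreal (a x - b x))" and "q = (\<lambda>x. ennreal (- (a x - b x)))"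
  have [measurable]: "p \<in> borel_measurable M" "q \<in> borel_measurable M"
    by (auto simp: p_def q_def)
  have eq: "(\<lambda>x. p x + ennreal (b x)) = (\<lambda>x. q x + ennreal (a x))"
  proof
    fix x
    show "p x + ennreal (b x) = q x + ennreal (a x)"
      using nonneg[of x] unfolding p_def q_def
      by (cases "a x \<le> b x") (simp_all add: ennreal_neg flip: ennreal_plus)
  qed
  have finp: "AE x in M. nn_cond_exp M F p x < \<infinity>"
    by (rule nn_cond_exp_finite_mono[OF fin(1)]) (auto simp: p_def nonneg intro!: ennreal_leI)
  have finq: "AE x in M. nn_cond_exp M F q x < \<infinity>"
    by (rule nn_cond_exp_finite_mono[OF fin(2)]) (auto simp: q_def nonneg intro!: ennreal_leI)
  have 1: "AE x in M. nn_cond_exp M F p x + nn_cond_exp M F (\<lambda>x. ennreal (b x)) x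
      = nn_cond_exp M F (\<lambda>x. p x + ennreal (b x)) x"
    by (rule nn_cond_exp_sum) auto
  have 2: "AE x in M. nn_cond_exp M F q x + nn_cond_exp M F (\<lambda>x. ennreal (a x)) x
      = nn_cond_exp M F (\<lambda>x. q x + ennreal (a x)) x"
    by (rule nn_cond_exp_sum) auto
  from 1 2 fin finp finq show ?thesis
  proof eventually_elim
    case (elim x)
    have "nn_cond_exp M F p x + nn_cond_exp M F (\<lambda>x. ennreal (b x)) x =
        nn_cond_exp M F q x + nn_cond_exp M F (\<lambda>x. ennreal (a x)) x"
      using elim eq by simp
    then have "enn2real (nn_cond_exp M F p x) + enn2real (nn_cond_exp M F (\<lambda>x. ennreal (b x)) x) =
        enn2real (nn_cond_exp M F q x) + enn2real (nn_cond_exp M F (\<lambda>x. ennreal (a x)) x)"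
      using elim by (metis enn2real_plus infinity_ennreal_def)
    then show ?case
      unfolding real_cond_exp_def p_def[symmetric] q_def[symmetric] by linarith
  qed
qed

lemma real_cond_exp_defined_parts:
  assumes "real_cond_exp_defined f"
  shows "f \<in> borel_measurable M"
    "AE x in M. nn_cond_exp M F (\<lambda>x. ennreal (f x)) x < \<infinity>"
    "AE x in M. nn_cond_exp M F (\<lambda>x. ennreal (- f x)) x < \<infinity>"
proof -
  show [measurable]: "f \<in> borel_measurable M"
    using assms by (simp add: real_cond_exp_defined_def)
  have fin: "AE x in M. nn_cond_exp M F (\<lambda>x. ennreal \<bar>f x\<bar>) x < \<infinity>"
    using assms by (simp add: real_cond_exp_defined_def)
  show "AE x in M. nn_cond_exp M F (\<lambda>x. ennreal (f x)) x < \<infinity>"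
    "AE x in M. nn_cond_exp M F (\<lambda>x. ennreal (- f x)) x < \<infinity>"
    by (rule nn_cond_exp_finite_mono[OF fin]; auto intro!: ennreal_leI)+
qed

lemma real_cond_exp_defined_add:
  assumes "real_cond_exp_defined f" "real_cond_exp_defined g"
  shows "real_cond_exp_defined (\<lambda>x. f x + g x)"
proof -
  have [measurable]: "f \<in> borel_measurable M" "g \<in> borel_measurable M"
    using assms by (auto simp: real_cond_exp_defined_def)
  have "AE x in M. nn_cond_exp M F (\<lambda>x. ennreal \<bar>f x\<bar> + ennreal \<bar>g x\<bar>) x < \<infinity>"
    using assms by (intro nn_cond_exp_finite_sum) (auto simp: real_cond_exp_defined_def)
  then have "AE x in M. nn_cond_exp M F (\<lambda>x. ennreal \<bar>f x + g x\<bar>) x < \<infinity>"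
    by (rule nn_cond_exp_finite_mono) (auto simp flip: ennreal_plus intro!: ennreal_leI)
  then show ?thesis by (simp add: real_cond_exp_defined_def)
qed

lemma real_cond_exp_defined_mult:
  assumes f: "real_cond_exp_defined f" and phi: "\<phi> \<in> borel_measurable F"
  shows "real_cond_exp_defined (\<lambda>x. \<phi> x * f x)"
proof -
  note [measurable] = phi measurable_from_subalg[OF subalg phi]
  have [measurable]: "f \<in> borel_measurable M"
    using f by (auto simp: real_cond_exp_defined_def)
  have "AE x in M. nn_cond_exp M F (\<lambda>x. ennreal \<bar>\<phi> x\<bar> * ennreal \<bar>f x\<bar>) x < \<infinity>"
    using f by (intro nn_cond_exp_finite_prod) (auto simp: real_cond_exp_defined_def)
  then show ?thesis
    by (simp add: real_cond_exp_defined_def abs_mult ennreal_mult)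
qed

lemma real_cond_exp_uminus:
  "real_cond_exp M F (\<lambda>x. - f x) x = - real_cond_exp M F f x"
  by (simp add: real_cond_exp_def)

lemma real_cond_exp_add_defined:
  assumes f: "real_cond_exp_defined f" and g: "real_cond_exp_defined g"
  shows "AE x in M. real_cond_exp M F (\<lambda>x. f x + g x) x = real_cond_exp M F f x + real_cond_exp M F g x"
proof -
  note [measurable] = real_cond_exp_defined_parts(1)[OF f] real_cond_exp_defined_parts(1)[OF g]
  note ff = real_cond_exp_defined_parts(2,3)[OF f] and gf = real_cond_exp_defined_parts(2,3)[OF g]
  let ?a = "\<lambda>x. max (f x) 0 + max (g x) 0" and ?b = "\<lambda>x. max (- f x) 0 + max (- g x) 0"
  have pos: "ennreal (max s 0 + max t 0) = ennreal s + ennreal t" for s t :: real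
    by (simp add: ennreal_plus)
  have "AE x in M. real_cond_exp M F (\<lambda>x. ?a x - ?b x) x =
    enn2real (nn_cond_exp M F (\<lambda>x. ennreal (?a x)) x) -
    enn2real (nn_cond_exp M F (\<lambda>x. ennreal (?b x)) x)"
  proof (rule real_cond_exp_difference)
    show "AE x in M. nn_cond_exp M F (\<lambda>x. ennreal (?a x)) x < \<infinity>"
      unfolding pos by (rule nn_cond_exp_finite_sum[OF ff(1) gf(1)]) auto
    show "AE x in M. nn_cond_exp M F (\<lambda>x. ennreal (?b x)) x < \<infinity>"
      unfolding pos by (rule nn_cond_exp_finite_sum[OF ff(2) gf(2)]) auto
  qed auto
  moreover have "AE x in M. nn_cond_exp M F (\<lambda>x. ennreal (f x)) x + nn_cond_exp M F (\<lambda>x. ennreal (g x)) x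
      = nn_cond_exp M F (\<lambda>x. ennreal (?a x)) x"
    unfolding pos by (rule nn_cond_exp_sum) auto
  moreover have "AE x in M. nn_cond_exp M F (\<lambda>x. ennreal (- f x)) x + nn_cond_exp M F (\<lambda>x. ennreal (- g x)) x
      = nn_cond_exp M F (\<lambda>x. ennreal (?b x)) x"
    unfolding pos by (rule nn_cond_exp_sum) auto
  ultimately show ?thesis
    using ff gf
  proof eventually_elim
    case (elim x)
    have a: "enn2real (nn_cond_exp M F (\<lambda>x. ennreal (?a x)) x) =
        enn2real (nn_cond_exp M F (\<lambda>x. ennreal (f x)) x) +
        enn2real (nn_cond_exp M F (\<lambda>x. ennreal (g x)) x)"
      unfolding elim(2)[symmetric] by (rule enn2real_plus) (use elim(4,6) in auto)
    have b: "enn2real (nn_cond_exp M F (\<lambda>x. ennreal (?b x)) x) =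
        enn2real (nn_cond_exp M F (\<lambda>x. ennreal (- f x)) x) +
        enn2real (nn_cond_exp M F (\<lambda>x. ennreal (- g x)) x)"
      unfolding elim(3)[symmetric] by (rule enn2real_plus) (use elim(5,7) in auto)
    have "(\<lambda>x. f x + g x) = (\<lambda>x. ?a x - ?b x)"
      by (auto simp: max_def)
    then have "real_cond_exp M F (\<lambda>x. f x + g x) x =
        enn2real (nn_cond_exp M F (\<lambda>x. ennreal (?a x)) x) -
        enn2real (nn_cond_exp M F (\<lambda>x. ennreal (?b x)) x)"
      using elim(1) by (simp only:)
    then show ?case
      unfolding a b real_cond_exp_def[of M F f] real_cond_exp_def[of M F g] by linarith
  qed
qed

lemma real_cond_exp_mult_nonneg:
  assumes f: "real_cond_exp_defined f" and phi: "\<phi> \<in> borel_measurable F" and nonneg: "\<And>x. 0 \<le> \<phi> x"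
  shows "AE x in M. real_cond_exp M F (\<lambda>x. \<phi> x * f x) x = \<phi> x * real_cond_exp M F f x"
proof -
  note [measurable] = phi measurable_from_subalg[OF subalg phi] real_cond_exp_defined_parts(1)[OF f]
  have "AE x in M. ennreal (\<phi> x) * nn_cond_exp M F (\<lambda>x. ennreal (f x)) x =
      nn_cond_exp M F (\<lambda>x. ennreal (\<phi> x) * ennreal (f x)) x"
    by (rule nn_cond_exp_prod) auto
  moreover have "AE x in M. ennreal (\<phi> x) * nn_cond_exp M F (\<lambda>x. ennreal (- f x)) x =
      nn_cond_exp M F (\<lambda>x. ennreal (\<phi> x) * ennreal (- f x)) x"
    by (rule nn_cond_exp_prod) auto
  ultimately show ?thesis
  proof eventually_elim
    case (elim x)
    have "(\<lambda>x. ennreal (\<phi> x * f x)) = (\<lambda>x. ennreal (\<phi> x) * ennreal (f x))"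
      "(\<lambda>x. ennreal (- (\<phi> x * f x))) = (\<lambda>x. ennreal (\<phi> x) * ennreal (- f x))"
      using nonneg ennreal_mult' by (auto simp only: fun_eq_iff mult_minus_right[symmetric])
    then show ?case
      by (simp only: real_cond_exp_def elim[symmetric] enn2real_mult)
        (simp add: nonneg right_diff_distrib)
  qed
qed

lemma real_cond_exp_mult_defined:
  assumes f: "real_cond_exp_defined f" and phi[measurable]: "\<phi> \<in> borel_measurable F"
  shows "AE x in M. real_cond_exp M F (\<lambda>x. \<phi> x * f x) x = \<phi> x * real_cond_exp M F f x"
proof -
  let ?p = "\<lambda>x. max (\<phi> x) 0" and ?q = "\<lambda>x. max (- \<phi> x) 0"
  have p: "real_cond_exp_defined (\<lambda>x. ?p x * f x)" and q: "real_cond_exp_defined (\<lambda>x. ?q x * f x)"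
    by (auto intro!: real_cond_exp_defined_mult[OF f])
  have q': "real_cond_exp_defined (\<lambda>x. - (?q x * f x))"
    using q by (simp add: real_cond_exp_defined_def)
  have "AE x in M. real_cond_exp M F (\<lambda>x. ?p x * f x) x = ?p x * real_cond_exp M F f x"
    "AE x in M. real_cond_exp M F (\<lambda>x. ?q x * f x) x = ?q x * real_cond_exp M F f x"
    by (auto intro!: real_cond_exp_mult_nonneg[OF f])
  then show ?thesis
    using real_cond_exp_add_defined[OF p q']
  proof eventually_elim
    case (elim x)
    have "(\<lambda>x. \<phi> x * f x) = (\<lambda>x. ?p x * f x + - (?q x * f x))"
      by (auto simp: max_def)
    then have "real_cond_exp M F (\<lambda>x. \<phi> x * f x) x =
        real_cond_exp M F (\<lambda>x. ?p x * f x + - (?q x * f x)) x"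
      by (simp only:)
    also have "\<dots> = (?p x - ?q x) * real_cond_exp M F f x"
      unfolding elim real_cond_exp_uminus by (simp add: left_diff_distrib)
    also have "?p x - ?q x = \<phi> x" by (auto simp: max_def)
    finally show ?case .
  qed
qed

lemma complex_cond_exp_measurable [measurable]:
  "complex_cond_exp M F f \<in> borel_measurable F"
  unfolding complex_cond_exp_def[abs_def] by (subst borel_measurable_complex_iff) auto

lemma cond_exp_defined_Re_Im:
  assumes "cond_exp_defined M F f"
  shows "real_cond_exp_defined (\<lambda>x. Re (f x))" "real_cond_exp_defined (\<lambda>x. Im (f x))"
proof -
  have [measurable]: "f \<in> borel_measurable M"
    and fin: "AE x in M. nn_cond_exp M F (\<lambda>x. ennreal (cmod (f x))) x < \<infinity>"
    using assms by (auto simp: cond_exp_defined_def)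
  show "real_cond_exp_defined (\<lambda>x. Re (f x))" "real_cond_exp_defined (\<lambda>x. Im (f x))"
    unfolding real_cond_exp_defined_def
    by (intro conjI nn_cond_exp_finite_mono[OF fin];
        auto intro!: ennreal_leI abs_Re_le_cmod abs_Im_le_cmod)+
qed

lemma complex_cond_exp_diff:
  assumes f: "cond_exp_defined M F f" and g: "cond_exp_defined M F g"
  shows "AE x in M. complex_cond_exp M F (\<lambda>x. f x - g x) x =
    complex_cond_exp M F f x - complex_cond_exp M F g x"
proof -
  note fd = cond_exp_defined_Re_Im[OF f] and gd = cond_exp_defined_Re_Im[OF g]
  have gd': "real_cond_exp_defined (\<lambda>x. - Re (g x))" "real_cond_exp_defined (\<lambda>x. - Im (g x))"
    using gd by (simp_all add: real_cond_exp_defined_def)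
  show ?thesis
    using real_cond_exp_add_defined[OF fd(1) gd'(1)] real_cond_exp_add_defined[OF fd(2) gd'(2)]
  proof eventually_elim
    case (elim x)
    have "(\<lambda>x. Re (f x - g x)) = (\<lambda>x. Re (f x) + - Re (g x))"
      "(\<lambda>x. Im (f x - g x)) = (\<lambda>x. Im (f x) + - Im (g x))"
      by auto
    then show ?case
      by (simp only: complex_cond_exp_def elim real_cond_exp_uminus) (simp add: complex_eq_iff)
  qed
qed

text \<open>The pull-out property, on which the formula \<open>E(u \<phi> w) = \<phi> E(w u)\<close> rests.\<close>

lemma complex_cond_exp_mult:
  assumes f: "cond_exp_defined M F f" and [measurable]: "\<phi> \<in> borel_measurable F"
  shows "AE x in M. complex_cond_exp M F (\<lambda>x. \<phi> x * f x) x = \<phi> x * complex_cond_exp M F f x"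
proof -
  note fd = cond_exp_defined_Re_Im[OF f]
  have m: "(\<lambda>x. Re (\<phi> x)) \<in> borel_measurable F" "(\<lambda>x. Im (\<phi> x)) \<in> borel_measurable F"
    "(\<lambda>x. - Im (\<phi> x)) \<in> borel_measurable F"
    by auto
  note d = real_cond_exp_defined_mult[OF _ m(1)] real_cond_exp_defined_mult[OF _ m(2)]
    real_cond_exp_defined_mult[OF _ m(3)]
  note e = real_cond_exp_mult_defined[OF _ m(1)] real_cond_exp_mult_defined[OF _ m(2)]
    real_cond_exp_mult_defined[OF _ m(3)]
  show ?thesis
    using real_cond_exp_add_defined[OF d(1)[OF fd(1)] d(3)[OF fd(2)]]
      real_cond_exp_add_defined[OF d(1)[OF fd(2)] d(2)[OF fd(1)]]
      e(1)[OF fd(1)] e(1)[OF fd(2)] e(2)[OF fd(1)] e(3)[OF fd(2)]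
  proof eventually_elim
    case (elim x)
    have "(\<lambda>x. Re (\<phi> x * f x)) = (\<lambda>x. Re (\<phi> x) * Re (f x) + - Im (\<phi> x) * Im (f x))"
      "(\<lambda>x. Im (\<phi> x * f x)) = (\<lambda>x. Re (\<phi> x) * Im (f x) + Im (\<phi> x) * Re (f x))"
      by auto
    then show ?case
      by (simp only: complex_cond_exp_def elim) (simp add: complex_eq_iff)
  qed
qed

lemma complex_cond_exp_cong:
  assumes eq: "AE x in M. f x = g x" and [measurable]: "f \<in> borel_measurable M" "g \<in> borel_measurable M"
  shows "AE x in M. complex_cond_exp M F f x = complex_cond_exp M F g x"
proof -
  have "AE x in M. Re (f x) = Re (g x)" "AE x in M. Im (f x) = Im (g x)"
    using eq by auto
  then have "AE x in M. real_cond_exp M F (\<lambda>x. Re (f x)) x = real_cond_exp M F (\<lambda>x. Re (g x)) x"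
    "AE x in M. real_cond_exp M F (\<lambda>x. Im (f x)) x = real_cond_exp M F (\<lambda>x. Im (g x)) x"
    using assms(2,3) by (intro real_cond_exp_cong; measurable)+
  then show ?thesis
    by eventually_elim (simp add: complex_cond_exp_def)
qed

end

section \<open>The splitting of the Orlicz space\<close>

lemma AE_from_countable_cover:
  assumes "\<And>n. n \<in> I \<Longrightarrow> AE x in M. x \<in> A n \<longrightarrow> P x" and "countable I"
    and "AE x in M. x \<in> (\<Union>n\<in>I. A n)"
  shows "AE x in M. P x"
proof -
  have "AE x in M. \<forall>n\<in>I. x \<in> A n \<longrightarrow> P x"
    using assms(1,2) by (subst AE_ball_countable) auto
  with assms(3) show ?thesis
    by eventually_elim auto
qed

lemma atomic_decomposition_covers:
  assumes dec: "atomic_decomposition M I A B" and "emeasure M B = 0"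
  shows "AE x in M. x \<in> (\<Union>n\<in>I. A n)"
proof -
  have "\<And>n. n \<in> I \<Longrightarrow> A n \<in> sets M" and B: "B = space M - (\<Union>n\<in>I. A n)"
    using dec by (auto simp: atomic_decomposition_def is_atom_def)
  then have "B \<in> sets M"
    by (auto intro!: sets.countable_UN')
  then have "AE x in M. x \<notin> B"
    using assms(2) by (intro AE_not_in) (auto simp: null_sets_def)
  with AE_space show ?thesis
    by eventually_elim (auto simp: B)
qed

context sigma_finite_subalgebra
begin

text \<open>The zero set \<open>Z\<close> of \<open>E(\<Psi>(u))\<close> belongs to the subalgebra, so the integral of \<open>\<Psi>(u)\<close> over \<open>Z\<close>
  equals that of \<open>E(\<Psi>(u))\<close>, which is \<open>0\<close>.\<close>

lemma cond_exp_young_zero_imp_zero: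
  assumes Y: "young_function \<Psi>" and pos: "\<And>y. y > 0 \<Longrightarrow> \<Psi> y > 0"
    and [measurable]: "u \<in> borel_measurable M"
  shows "AE x in M. nn_cond_exp M F (\<lambda>x. \<Psi> (cmod (u x))) x = 0 \<longrightarrow> u x = 0"
proof -
  let ?e = "nn_cond_exp M F (\<lambda>x. \<Psi> (cmod (u x)))"
  define Z where "Z = {x\<in>space F. ?e x = 0}"
  have [measurable]: "Z \<in> sets F" unfolding Z_def by measurable
  have ZM[measurable]: "Z \<in> sets M"
    using subalg \<open>Z \<in> sets F\<close> by (auto simp: subalgebra_def)
  have sp: "space F = space M" using subalg by (simp add: subalgebra_def)
  have m[measurable]: "(\<lambda>x. \<Psi> (cmod (u x))) \<in> borel_measurable M"
    by (rule young_measurable[OF Y]) auto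
  have "(\<integral>\<^sup>+x. indicator Z x * \<Psi> (cmod (u x)) \<partial>M) = (\<integral>\<^sup>+x. indicator Z x * ?e x \<partial>M)"
    by (rule nn_cond_exp_intg[symmetric]) auto
  also have "\<dots> = 0"
    by (auto simp: Z_def indicator_def intro!: nn_integral_zero')
  finally have "AE x in M. indicator Z x * \<Psi> (cmod (u x)) = 0"
    by (subst (asm) nn_integral_0_iff_AE) auto
  with AE_space show ?thesis
  proof eventually_elim
    case (elim x)
    then show ?case
      using pos[of "cmod (u x)"] by (cases "u x = 0") (auto simp: Z_def sp)
  qed
qed

text \<open>By this, atoms outside \<open>H\<^sub>m\<close> have \<open>E(w u) w = 0\<close> even if it is the factor
  \<open>\<Psi>\<^sup>-\<^sup>1(E(\<Psi>(u)))\<close> of the defining product that vanishes. If \<open>\<Psi>\<close> has a positive zero, that factor never vanishes. Otherwise it vanishes only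
  where \<open>E(\<Psi>(u)) = 0\<close>; there \<open>u = 0\<close>, and multiplying \<open>w u\<close> by the indicator \<open>\<phi>\<close> of that set
  gives \<open>0\<close>.\<close>

lemma cond_exp_vanishes_where_factor_vanishes:
  assumes Y: "young_function \<Psi>" and [measurable]: "u \<in> borel_measurable M"
    and d: "cond_exp_defined M F (\<lambda>x. w x * u x)"
  shows "AE x in M. young_inverse \<Psi> (nn_cond_exp M F (\<lambda>x. \<Psi> (cmod (u x))) x) = 0 \<longrightarrow>
    complex_cond_exp M F (\<lambda>x. w x * u x) x = 0"
proof (cases "\<forall>y>0. \<Psi> y > 0")
  case False
  then have "young_inverse \<Psi> y \<noteq> 0" for y
    using young_inverse_eq_0(2)[OF Y] by blast
  then show ?thesis by simp
next
  case True
  let ?e = "nn_cond_exp M F (\<lambda>x. \<Psi> (cmod (u x)))"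
  define \<phi> :: "'a \<Rightarrow> complex" where "\<phi> = (\<lambda>x. if ?e x = 0 then 1 else 0)"
  have phi[measurable]: "\<phi> \<in> borel_measurable F" unfolding \<phi>_def by measurable
  have [measurable]: "\<phi> \<in> borel_measurable M" using subalg phi by (rule measurable_from_subalg)
  have [measurable]: "(\<lambda>x. w x * u x) \<in> borel_measurable M"
    using d by (simp add: cond_exp_defined_def)
  have "AE x in M. \<phi> x * (w x * u x) = 0"
    using cond_exp_young_zero_imp_zero[OF Y, of u] True
    by (auto simp: \<phi>_def elim!: eventually_mono)
  then have "AE x in M. complex_cond_exp M F (\<lambda>x. \<phi> x * (w x * u x)) x = complex_cond_exp M F (\<lambda>_. 0) x"
    by (intro complex_cond_exp_cong) auto
  with complex_cond_exp_mult[OF d phi] show ?thesis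
  proof eventually_elim
    case (elim x)
    have "complex_cond_exp M F (\<lambda>_. 0) x = 0"
      by (simp add: complex_cond_exp_def real_cond_exp_def complex_eq_iff)
    then show ?case
      using elim young_inverse_eq_0(1)[OF Y, of "?e x"] by (auto simp: \<phi>_def)
  qed
qed

end

theorem corollary2p8:
  fixes M F :: "'a measure" and \<Phi> \<Psi> :: "real \<Rightarrow> ennreal"
    and I :: "nat set" and A :: "nat \<Rightarrow> 'a set" and B :: "'a set"
    and u w :: "'a \<Rightarrow> complex" and m :: nat
  defines "L \<equiv> orlicz_space M \<Phi>"
    and "T \<equiv> wct_op M F w u"
    and "Ewu \<equiv> complex_cond_exp M F (mult_op w u)"
  assumes "complete_measure M" and "sigma_finite_measure M"
    and "sigma_finite_subalgebra M F"
    and "atomic_decomposition M I A B" and "emeasure M B = 0"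
    and "complementary_young_pair \<Phi> \<Psi>"
    and "GCH_inequality M F \<Phi> \<Psi>"
    and "u \<in> borel_measurable M" and "w \<in> borel_measurable M"
    and "wct_defined M F \<Phi> w u"
    and "bounded_on_orlicz M \<Phi> T"
    and "m \<ge> 1" and "finite (H_set M F \<Psi> I A w u m)"
  shows "(\<forall>j k :: nat. j \<ge> 1 \<and> k \<ge> 1 \<and> j + k \<ge> 2 \<longrightarrow>
            closedin (orlicz_topology M \<Phi>)
              (sum_space (range_space M \<Phi> (mult_op (\<lambda>x. Ewu x ^ j) \<circ> T))
                         (null_space M \<Phi> (mult_op (\<lambda>x. Ewu x ^ k) \<circ> T))))
         \<and> L = sum_space (range_space M \<Phi> (mult_op Ewu \<circ> T)) (null_space M \<Phi> (mult_op Ewu \<circ> T))"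
proof -
  interpret sigma_finite_subalgebra M F by fact
  note sf = \<open>sigma_finite_measure M\<close> and dec = \<open>atomic_decomposition M I A B\<close>
  note [measurable] = \<open>u \<in> borel_measurable M\<close> \<open>w \<in> borel_measurable M\<close>
  have Y: "young_function \<Phi>" and Y': "young_function \<Psi>"
    using \<open>complementary_young_pair \<Phi> \<Psi>\<close> by (auto simp: complementary_young_pair_def)
  have at: "is_atom M (A n)" if "n \<in> I" for n
    using dec that by (auto simp: atomic_decomposition_def)
  have comm: "mult_op u w = mult_op w u" by (auto simp: mult_op_def)
  have dwu: "cond_exp_defined M F (\<lambda>x. w x * u x)"
    using \<open>wct_defined M F \<Phi> w u\<close> by (simp add: wct_defined_def comm) (simp add: mult_op_def)
  have duf: "cond_exp_defined M F (\<lambda>x. u x * f x)" if "f \<in> L" for f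
    using \<open>wct_defined M F \<Phi> w u\<close> that by (auto simp: wct_defined_def mult_op_def L_def)
  have Ewu: "Ewu = complex_cond_exp M F (\<lambda>x. w x * u x)"
    by (simp add: Ewu_def mult_op_def)
  have EwuF[measurable]: "Ewu \<in> borel_measurable F" by (simp add: Ewu_def)
  have [measurable]: "Ewu \<in> borel_measurable M" using subalg EwuF by (rule measurable_from_subalg)
  have T: "T f x = w x * complex_cond_exp M F (\<lambda>x. u x * f x) x" for f x
    by (simp add: T_def wct_op_def mult_op_def)
  define H where "H = H_set M F \<Psi> I A w u m"
  define S where "S = (\<Union>n\<in>H. A n)"
  have H: "finite H" "H \<subseteq> I" using assms by (auto simp: H_def H_set_def)
  have SM[measurable]: "S \<in> sets M"
    using H at unfolding S_def by (intro sets.finite_UN) (auto simp: is_atom_def)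
  have Sfin: "emeasure M S < \<infinity>"
  proof -
    have "emeasure M S \<le> (\<Sum>n\<in>H. emeasure M (A n))"
      unfolding S_def using H at by (intro emeasure_subadditive_finite) (auto simp: is_atom_def)
    also have "\<dots> < \<infinity>"
      using H at atom_finite_measure[OF sf] by (auto simp: ennreal_sum_less_top)
    finally show ?thesis .
  qed
  have cov: "AE x in M. x \<in> (\<Union>n\<in>I. A n)"
    using dec \<open>emeasure M B = 0\<close> by (rule atomic_decomposition_covers)

  \<comment> \<open>Off the atoms of \<open>H\<close> one of the three factors in the definition of \<open>H_set\<close> is zero.\<close>
  have vanish: "AE x in M. x \<notin> S \<longrightarrow> Ewu x * w x = 0"
  proof (rule AE_from_countable_cover[OF _ _ cov])
    show "countable I" by simp
    fix n assume n: "n \<in> I"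
    let ?y = "\<lambda>x. young_inverse \<Psi> (nn_cond_exp M F (\<lambda>x. \<Psi> (cmod (u x))) x)"
    have [measurable]: "young_inverse \<Psi> \<in> borel_measurable borel"
      by (intro mono_imp_borel_measurable young_inverse_mono)
    have "(\<lambda>x. Ewu x ^ m) \<in> borel_measurable M" "?y \<in> borel_measurable M"
      by measurable
    note av = atom_value_ae[OF sf at[OF n] this(1)] atom_value_ae[OF sf at[OF n] this(2)]
      atom_value_ae[OF sf at[OF n] \<open>w \<in> borel_measurable M\<close>]
    show "AE x in M. x \<in> A n \<longrightarrow> x \<notin> S \<longrightarrow> Ewu x * w x = 0"
    proof (cases "n \<in> H")
      case True
      then show ?thesis by (auto simp: S_def)
    next
      case False
      then have "ennreal (cmod (atom_value M (\<lambda>x. Ewu x ^ m) (A n) * atom_value M w (A n)))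
          * atom_value M ?y (A n) = 0"
        using n by (simp add: H_def H_set_def Ewu_def)
      then have "atom_value M (\<lambda>x. Ewu x ^ m) (A n) = 0 \<or> atom_value M w (A n) = 0
          \<or> atom_value M ?y (A n) = 0"
        by (simp add: ennreal_eq_0_iff)
      with av cond_exp_vanishes_where_factor_vanishes[OF Y' _ dwu] show ?thesis
        unfolding Ewu[symmetric] by (auto elim!: eventually_elim2)
    qed
  qed

  \<comment> \<open>Such a product is constant on each of the finitely many atoms in \<open>S\<close> and zero elsewhere.\<close>
  have phiw: "(\<lambda>x. \<phi> x * w x) \<in> L"
    if [measurable]: "\<phi> \<in> borel_measurable F" and z: "\<And>x. Ewu x = 0 \<Longrightarrow> \<phi> x = 0" for \<phi>
  proof -
    have [measurable]: "\<phi> \<in> borel_measurable M"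
      using subalg \<open>\<phi> \<in> borel_measurable F\<close> by (rule measurable_from_subalg)
    have hm: "(\<lambda>x. \<phi> x * w x) \<in> borel_measurable M" by measurable
    define C where "C = (\<Sum>n\<in>H. cmod (atom_value M (\<lambda>x. \<phi> x * w x) (A n)))"
    have "AE x in M. \<forall>n\<in>H. x \<in> A n \<longrightarrow> \<phi> x * w x = atom_value M (\<lambda>x. \<phi> x * w x) (A n)"
      using H at by (subst AE_ball_countable) (auto intro!: atom_value_ae[OF sf _ hm] countable_finite)
    with vanish have "AE x in M. cmod (\<phi> x * w x) \<le> C * indicator S x"
    proof eventually_elim
      case (elim x)
      show ?case
      proof (cases "x \<in> S")
        case True
        then obtain n where n: "n \<in> H" "x \<in> A n" by (auto simp: S_def)
        have "cmod (atom_value M (\<lambda>x. \<phi> x * w x) (A n)) \<le> C"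
          unfolding C_def using H n by (intro member_le_sum) auto
        then show ?thesis using True elim n by simp
      next
        case False
        then show ?thesis using elim z by auto
      qed
    qed
    then show ?thesis
      unfolding L_def using Y hm SM Sfin by (rule bounded_finite_support_in_orlicz_space[rotated -1])
  qed

  have main: "L \<subseteq> sum_space (range_space M \<Phi> (mult_op (\<lambda>x. Ewu x ^ j) \<circ> T))
                         (null_space M \<Phi> (mult_op (\<lambda>x. Ewu x ^ k) \<circ> T))"
    if "k \<ge> 1" for j k
  proof
    fix f assume f: "f \<in> L"
    define e where "e = complex_cond_exp M F (\<lambda>x. u x * f x)"
    have [measurable]: "e \<in> borel_measurable F" by (simp add: e_def)
    \<comment> \<open>Division by zero gives \<open>0\<close>, so \<open>\<phi> i\<close> vanishes where \<open>Ewu\<close> does; \<open>T\<close> lowers the exponent of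
      \<open>Ewu\<close> in the denominator by one.\<close>
    define \<phi> where "\<phi> i x = e x / Ewu x ^ Suc i" for i x
    have phi[measurable]: "\<phi> i \<in> borel_measurable F" for i unfolding \<phi>_def by measurable
    define h where "h i = (\<lambda>x. \<phi> i x * w x)" for i
    have h: "h i \<in> L" for i
      unfolding h_def by (rule phiw) (auto simp: \<phi>_def)
    have Eh: "AE x in M. complex_cond_exp M F (\<lambda>x. u x * h i x) x = \<phi> i x * Ewu x" for i
      using complex_cond_exp_mult[OF dwu phi[of i]]
      by (simp add: h_def Ewu mult_ac)
    have range: "h 0 \<in> range_space M \<Phi> (mult_op (\<lambda>x. Ewu x ^ j) \<circ> T)"
    proof -
      have "AE x in M. h 0 x = Ewu x ^ j * T (h (Suc j)) x"
        using Eh[of "Suc j"]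
      proof eventually_elim
        case (elim x)
        then show ?case
          by (cases "Ewu x = 0") (simp_all add: T h_def \<phi>_def)
      qed
      then show ?thesis
        using h by (auto simp: range_space_def mult_op_def L_def)
    qed
    have dL: "(\<lambda>x. f x - h 0 x) \<in> L"
      using f h Y by (auto simp: L_def intro: orlicz_space_diff)
    have null: "(\<lambda>x. f x - h 0 x) \<in> null_space M \<Phi> (mult_op (\<lambda>x. Ewu x ^ k) \<circ> T)"
    proof -
      have "AE x in M. Ewu x ^ k * T (\<lambda>x. f x - h 0 x) x = 0"
        using Eh[of 0] complex_cond_exp_diff[OF duf[OF f] duf[OF h[of 0]]]
      proof eventually_elim
        case (elim x)
        then show ?case
          using \<open>k \<ge> 1\<close>
          by (cases "Ewu x = 0") (simp_all add: T right_diff_distrib \<phi>_def e_def)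
      qed
      then show ?thesis
        using dL by (auto simp: null_space_def mult_op_def L_def)
    qed
    have "f = (\<lambda>x. h 0 x + (f x - h 0 x))" by auto
    then show "f \<in> sum_space (range_space M \<Phi> (mult_op (\<lambda>x. Ewu x ^ j) \<circ> T))
                         (null_space M \<Phi> (mult_op (\<lambda>x. Ewu x ^ k) \<circ> T))"
      unfolding sum_space_def mem_Collect_eq
      by (intro exI[of _ "h 0"] exI[of _ "\<lambda>x. f x - h 0 x"] conjI range null)
  qed
  have "sum_space (range_space M \<Phi> P) (null_space M \<Phi> Q) \<subseteq> L" for P Q
    using Y by (auto simp: sum_space_def range_space_def null_space_def L_def intro: orlicz_space_add)
  with main have eq: "sum_space (range_space M \<Phi> (mult_op (\<lambda>x. Ewu x ^ j) \<circ> T))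
      (null_space M \<Phi> (mult_op (\<lambda>x. Ewu x ^ k) \<circ> T)) = L" if "k \<ge> 1" for j k
    using that by (intro subset_antisym) auto
  have "closedin (orlicz_topology M \<Phi>) L"
    using closedin_topspace[of "orlicz_topology M \<Phi>"] by (simp add: topspace_orlicz_topology L_def)
  then show ?thesis
    using eq eq[of 1 1] by simp
qed

end
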